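(* Let $d\in\mathbb{N}$, $d\ge 1$, let $\mu$ be a probability measure on $\Gamma_1=\mathbb{T}^d\times\mathbb{R}^d$, let $N\in\mathbb{N}$ with $N\geq 1$, and let $I\subset\mathbb{T}^d$ be measurable. Suppose there exist $C_\mu>0$ and $r>0$ such that for all $t>0$ $$\big|\mathbb{E}_N(f_{I,t})-|I|\big|\leq C_\mu t^{-2r}.$$ Let $\epsilon>0$ and $\Delta t>0$, and set $$t_0=\epsilon^{-\frac{1}{2r}}D_\mu,\qquad D_\mu=(2C_\mu)^{\frac{1}{2r}},\qquad t_k=t_0+k\Delta t\quad (k=1,2,\dots).$$ For $K\in\mathbb{N}$ let $\Omega_{I,K}=\bigcap_{k=1}^{K}\Omega_I(\epsilon,N,t_k)$. Then, for all $K\in\mathbb{N}$ with $K\geq 1$, $$P(\Omega_{I,K})\geq 1-2K\exp\left(-\tfrac12\epsilon^2N\right).$$ In particular, if $K_N=\frac12\exp\left(\frac{\epsilon^2}{4}N\right)$ and $\Omega_{I,K_N}$ denotes the intersection of the sets $\Omega_I(\epsilon,N,t_k)$ over all integers $k$ with $1\leq k\leq K_N$, then $$P(\Omega_{I,K_N})\geq 1-\exp\left(-\tfrac14\epsilon^2N\right).$$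
   Context: $\mathbb{T}^d=\mathbb{R}^d/\mathbb{Z}^d$ is the $d$-dimensional torus, identified with the unit cube; $|I|$ denotes the Lebesgue measure of a measurable set $I\subset\mathbb{T}^d$ (so $|\mathbb{T}^d|=1$). The phase space of $N$ particles is $\Gamma_N=(\mathbb{T}^d\times\mathbb{R}^d)^N$, with points $(X,P)=(x_i,p_i)_{i=1,\dots,N}$. Particles move freely: at time $t$ particle $i$ is at $x_i+p_it$ (modulo $\mathbb{Z}^d$). The initial conditions $(x_i,p_i)$ are drawn independently from $\mu$; that is, $P(\cdot)$ (of subsets of $\Gamma_N$) and $\mathbb{E}_N$ denote probability and expectation with respect to the product measure $\mu^{\otimes N}$ on $\Gamma_N$. With $\chi_I$ the ($\mathbb{Z}^d$-periodic) characteristic function of $I$, the fraction of particles in $I$ at time $t$ is $$f_{I,t}(X,P)=f_I(X,P,t)=\frac1N\sum_{i=1}^N\chi_I(x_i+p_it).$$ (Note $\mathbb{E}_N(f_{I,t})=\int_{\Gamma_1}\chi_I(x+pt)\,d\mu(x,p)$, independent of $N$.) For $\epsilon>0$, $t>0$, $$\Omega_I(\epsilon,N,t)=\{(X,P)\in\Gamma_N : |f_I(X,P,t)-|I||\leq\epsilon\}.$$ *)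

theory Defs
  imports "HOL-Probability.Probability"
begin

text \<open>The torus \<open>\<real>\<^sup>d/\<int>\<^sup>d\<close> is identified with the half-open unit cube, which contains exactly one
  representative of each class; \<open>wrap\<close> is the projection modulo \<open>\<int>\<^sup>d\<close>. The dimension is \<open>CARD('d)\<close>.\<close>

definition unit_cube :: "(real ^ 'd) set" where
  "unit_cube = {x. \<forall>i. 0 \<le> x $ i \<and> x $ i < 1}"

definition wrap :: "real ^ 'd \<Rightarrow> real ^ 'd" where
  "wrap y = (\<chi> i. frac (y $ i))"

text \<open>Measurable sets are Borel sets: for Lebesgue sets, \<open>\<chi>\<^sub>I(x + pt)\<close> need not be measurable
  with respect to an arbitrary \<open>\<mu>\<close>.\<close>

definition torus :: "(real ^ 'd) measure" where
  "torus = restrict_space lborel unit_cube"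

definition Gamma1 :: "((real ^ 'd) \<times> (real ^ 'd)) measure" where
  "Gamma1 = torus \<Otimes>\<^sub>M lborel"

definition Gamma :: "nat \<Rightarrow> (nat \<Rightarrow> (real ^ 'd) \<times> (real ^ 'd)) measure" where
  "Gamma N = (\<Pi>\<^sub>M i\<in>{1..N}. Gamma1)"

definition init_distr ::
    "((real ^ 'd) \<times> (real ^ 'd)) measure \<Rightarrow> nat \<Rightarrow> (nat \<Rightarrow> (real ^ 'd) \<times> (real ^ 'd)) measure" where
  "init_distr \<mu> N = (\<Pi>\<^sub>M i\<in>{1..N}. \<mu>)"

definition periodic_indicator :: "(real ^ 'd) set \<Rightarrow> real ^ 'd \<Rightarrow> real" where
  "periodic_indicator I y = indicator I (wrap y)"

definition frac_in ::
    "(real ^ 'd) set \<Rightarrow> nat \<Rightarrow> real \<Rightarrow> (nat \<Rightarrow> (real ^ 'd) \<times> (real ^ 'd)) \<Rightarrow> real" where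
  "frac_in I N t \<omega> =
     (1 / real N) * (\<Sum>i=1..N. periodic_indicator I (fst (\<omega> i) + t *\<^sub>R snd (\<omega> i)))"

definition Omega ::
    "(real ^ 'd) set \<Rightarrow> real \<Rightarrow> nat \<Rightarrow> real \<Rightarrow> (nat \<Rightarrow> (real ^ 'd) \<times> (real ^ 'd)) set" where
  "Omega I \<epsilon> N t = {\<omega> \<in> space (Gamma N). \<bar>frac_in I N t \<omega> - measure torus I\<bar> \<le> \<epsilon>}"

text \<open>\<open>K\<close> is real because it is also used with \<open>K = exp(\<epsilon>\<^sup>2N/4)/2\<close>. If \<open>K < 1\<close>, the empty
  intersection is the whole phase space rather than \<open>UNIV\<close>.\<close>

definition Omega_upto ::
    "(real ^ 'd) set \<Rightarrow> real \<Rightarrow> nat \<Rightarrow> (nat \<Rightarrow> real) \<Rightarrow> real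
      \<Rightarrow> (nat \<Rightarrow> (real ^ 'd) \<times> (real ^ 'd)) set" where
  "Omega_upto I \<epsilon> N t K =
     space (Gamma N) \<inter> (\<Inter>k\<in>{k. 1 \<le> k \<and> real k \<le> K}. Omega I \<epsilon> N (t k))"

end

theory Submission
  imports Defs
begin

text \<open>For \<open>k \<ge> 1\<close> we have \<open>t\<^sub>k \<ge> t\<^sub>0\<close>, and \<open>t\<^sub>0\<close> is the time at which \<open>C\<^sub>\<mu> t\<^bsup>-2r\<^esup> = \<epsilon>/2\<close>. Hence leaving
  \<open>\<Omega>\<^sub>I(\<epsilon>,N,t\<^sub>k)\<close> forces \<open>f\<^sub>I\<close>, an average of \<open>N\<close> independent variables with values in \<open>{0,1}\<close>, to deviate
  from its mean by at least \<open>\<epsilon>/2\<close>. Hoeffding's inequality bounds the probability of this event by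
  \<open>2 exp(-\<epsilon>\<^sup>2N/2)\<close>, and a union bound over \<open>k\<close> concludes.\<close>

lemma borel_measurable_wrap [measurable]: "wrap \<in> borel_measurable borel"
proof (rule borel_measurable_euclidean_space[THEN iffD2], rule ballI)
  fix b :: "real ^ 'd" assume "b \<in> Basis"
  then obtain i where b: "b = axis i 1"
    by (auto simp: Basis_vec_def)
  have "(\<lambda>y :: real ^ 'd. frac (y $ i)) \<in> borel_measurable borel"
    unfolding frac_def by measurable
  then show "(\<lambda>y. wrap y \<bullet> b) \<in> borel_measurable borel"
    by (simp add: b wrap_def inner_axis)
qed

lemma wrap_in_unit_cube: "wrap y \<in> unit_cube"
  by (simp add: wrap_def unit_cube_def frac_lt_1)

lemma measurable_wrap_torus: "wrap \<in> measurable borel torus"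
  unfolding torus_def
  by (intro measurable_restrict_space2) (simp_all add: wrap_in_unit_cube)

lemma borel_measurable_periodic_indicator:
  assumes "I \<in> sets torus"
  shows "periodic_indicator I \<in> borel_measurable borel"
proof -
  have "(indicator I :: _ \<Rightarrow> real) \<in> borel_measurable torus"
    using assms by simp
  from measurable_compose[OF measurable_wrap_torus this] show ?thesis
    by (simp add: periodic_indicator_def[abs_def])
qed

text \<open>Inclusion of the cube into the ambient space is measurable, so the free motion can be
  formed there first and reduced modulo the integer lattice afterwards.\<close>

lemma borel_measurable_periodic_indicator_flow:
  assumes "I \<in> sets torus"
  shows "(\<lambda>z. periodic_indicator I (fst z + s *\<^sub>R snd z)) \<in> borel_measurable Gamma1"
proof -
  have "(\<lambda>x. x) \<in> borel_measurable torus"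
    unfolding torus_def by (intro measurable_restrict_space1) simp
  then have "(\<lambda>z. fst z + s *\<^sub>R snd z) \<in> borel_measurable Gamma1"
    unfolding Gamma1_def
    by (intro borel_measurable_add borel_measurable_scaleR)
       (auto intro: measurable_compose[OF measurable_fst] measurable_compose[OF measurable_snd])
  from measurable_compose[OF this borel_measurable_periodic_indicator[OF assms]] show ?thesis .
qed

text \<open>Independence means that the joint law is the product of the marginals. Here the joint
  law of the coordinates is \<open>PiM J M\<close> itself, and the marginals are the
  \<open>M i\<close>.\<close>

lemma indep_vars_PiM_components:
  assumes M: "\<And>i. i \<in> J \<Longrightarrow> prob_space (M i)" and "J \<noteq> {}"
  shows "prob_space.indep_vars (PiM J M) M (\<lambda>i \<omega>. \<omega> i) J"
proof -
  interpret prob_space "PiM J M"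
    using M by (rule prob_space_PiM)
  \<comment> \<open>Points of the product space are extensional, so restricting them to
    \<open>J\<close> changes nothing.\<close>
  have "distr (PiM J M) (PiM J M) (\<lambda>\<omega>. \<lambda>i\<in>J. \<omega> i) = distr (PiM J M) (PiM J M) (\<lambda>\<omega>. \<omega>)"
    by (intro distr_cong) (auto simp: space_PiM PiE_iff extensional_restrict)
  also have "\<dots> = PiM J M"
    by simp
  also have "\<dots> = PiM J (\<lambda>i. distr (PiM J M) (M i) (\<lambda>\<omega>. \<omega> i))"
    using M by (intro PiM_cong) (simp_all add: distr_PiM_component)
  finally show ?thesis
    using \<open>J \<noteq> {}\<close> by (subst indep_vars_iff_distr_eq_PiM') auto
qed

text \<open>Hoeffding's inequality for the sum of \<open>n = card J\<close> variables, with
  deviation \<open>\<delta> * n\<close>. Each range has width 1, so the exponent is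
  \<open>- 2 * (\<delta> * n)\<^sup>2 / n\<close>.\<close>

lemma iid_average_tail:
  fixes h :: "'a \<Rightarrow> real" and J :: "'i set"
  assumes M: "prob_space M" and J: "finite J" "J \<noteq> {}"
    and h: "h \<in> borel_measurable M" "\<And>x. x \<in> space M \<Longrightarrow> h x \<in> {0..1}"
    and "\<delta> \<ge> 0"
  defines "P \<equiv> PiM J (\<lambda>_. M)"
    and "A \<equiv> \<lambda>\<omega>. (1 / real (card J)) * (\<Sum>i\<in>J. h (\<omega> i))"
  shows "measure P {\<omega> \<in> space P. \<bar>A \<omega> - (\<integral>\<omega>. A \<omega> \<partial>P)\<bar> \<ge> \<delta>}
    \<le> 2 * exp (- 2 * \<delta>\<^sup>2 * real (card J))"
proof -
  interpret P: prob_space P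
    unfolding P_def by (intro prob_space_PiM M)
  have n: "real (card J) > 0"
    using J by (simp add: card_gt_0_iff)
  have "P.indep_vars (\<lambda>_. M) (\<lambda>i \<omega>. \<omega> i) J"
    unfolding P_def by (intro indep_vars_PiM_components M J)
  then have indep: "P.indep_vars (\<lambda>_. borel) (\<lambda>i \<omega>. h (\<omega> i)) J"
    by (rule P.indep_vars_compose2) (use h in simp)
  interpret H: Hoeffding_ineq P J "\<lambda>i \<omega>. h (\<omega> i)" "\<lambda>_. 0" "\<lambda>_. 1"
    "\<Sum>i\<in>J. (\<integral>\<omega>. h (\<omega> i) \<partial>P)"
  proof unfold_locales
    fix i assume "i \<in> J"
    then have "h (\<omega> i) \<in> {0..1}" if "\<omega> \<in> space P" for \<omega>
      using that by (intro h(2)) (auto simp: P_def space_PiM)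
    then show "AE \<omega> in P. h (\<omega> i) \<in> {0..1}"
      by (rule AE_I2)
  qed (use J indep in auto)
  \<comment> \<open>Integrability allows the expectation to pass through the sum, so the mean of
    \<open>A\<close> matches the centering used in Hoeffding's inequality.\<close>
  have "integrable P (\<lambda>\<omega>. h (\<omega> i))" if "i \<in> J" for i
    using interval_bounded_random_variable.integrable[OF H.bounded_random_variable[OF that]] .
  then have "(\<integral>\<omega>. A \<omega> \<partial>P) = (1 / real (card J)) * (\<Sum>i\<in>J. (\<integral>\<omega>. h (\<omega> i) \<partial>P))"
    unfolding A_def by simp
  then have "\<bar>A \<omega> - (\<integral>\<omega>. A \<omega> \<partial>P)\<bar>
      = \<bar>(\<Sum>i\<in>J. h (\<omega> i)) - (\<Sum>i\<in>J. (\<integral>\<omega>. h (\<omega> i) \<partial>P))\<bar> / real (card J)" for \<omega>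
    using n unfolding A_def by (simp add: diff_divide_distrib[symmetric])
  then have "{\<omega> \<in> space P. \<bar>A \<omega> - (\<integral>\<omega>. A \<omega> \<partial>P)\<bar> \<ge> \<delta>}
      = {\<omega> \<in> space P. \<bar>(\<Sum>i\<in>J. h (\<omega> i)) - (\<Sum>i\<in>J. (\<integral>\<omega>. h (\<omega> i) \<partial>P))\<bar> \<ge> \<delta> * real (card J)}"
    using n by (simp add: pos_le_divide_eq)
  also have "measure P \<dots> \<le> 2 * exp (- 2 * (\<delta> * real (card J))\<^sup>2 / (\<Sum>i\<in>J. (1 - 0)\<^sup>2))"
    using n \<open>\<delta> \<ge> 0\<close> by (intro H.Hoeffding_ineq_abs_ge) simp_all
  also have "\<dots> = 2 * exp (- 2 * \<delta>\<^sup>2 * real (card J))"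
    using n by (simp add: power2_eq_square)
  finally show ?thesis .
qed

text \<open>Union bound on the complements. Intersecting with \<open>space M\<close> keeps the
  statement meaningful for empty \<open>S\<close>, where the indexed intersection is
  \<open>UNIV\<close>.\<close>

lemma prob_INT_ge_union_bound:
  assumes "prob_space M" "finite S" "\<And>k. k \<in> S \<Longrightarrow> A k \<in> sets M"
    and "\<And>k. k \<in> S \<Longrightarrow> measure M (space M - A k) \<le> q"
  shows "measure M (space M \<inter> (\<Inter>k\<in>S. A k)) \<ge> 1 - real (card S) * q"
proof -
  interpret prob_space M by fact
  have "space M \<inter> (\<Inter>k\<in>S. A k) = space M - (\<Union>k\<in>S. space M - A k)"
    by auto
  also have "prob \<dots> = 1 - prob (\<Union>k\<in>S. space M - A k)"
    using assms by (intro prob_compl sets.finite_UN) auto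
  finally have "prob (space M \<inter> (\<Inter>k\<in>S. A k)) = 1 - prob (\<Union>k\<in>S. space M - A k)" .
  moreover have "prob (\<Union>k\<in>S. space M - A k) \<le> (\<Sum>k\<in>S. prob (space M - A k))"
    using assms by (intro finite_measure_subadditive_finite) auto
  moreover have "\<dots> \<le> (\<Sum>k\<in>S. q)"
    using assms by (intro sum_mono) auto
  ultimately show ?thesis by simp
qed

text \<open>The power with exponent \<open>- 2 * r\<close> decreases in \<open>s\<close>, so the
  threshold itself is the worst case, and there equality holds.\<close>

lemma decay_at_threshold:
  fixes C r \<epsilon> s :: real
  assumes "C > 0" "r > 0" "\<epsilon> > 0"
    and "s \<ge> \<epsilon> powr (- 1 / (2 * r)) * (2 * C) powr (1 / (2 * r))"
  shows "C * s powr (- 2 * r) \<le> \<epsilon> / 2"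
proof -
  let ?t0 = "\<epsilon> powr (- 1 / (2 * r)) * (2 * C) powr (1 / (2 * r))"
  have "?t0 > 0" using assms by simp
  then have "s powr (- 2 * r) \<le> ?t0 powr (- 2 * r)"
    using assms by (intro powr_mono2') simp_all
  \<comment> \<open>Multiplied by \<open>- 2 * r\<close>, the two exponents of the threshold become
    1 and -1.\<close>
  also have "\<dots> = \<epsilon> * (2 * C) powr (- 1)"
    using assms by (simp add: powr_mult powr_powr)
  also have "\<dots> = \<epsilon> / (2 * C)"
    using assms by (simp add: powr_minus_divide)
  finally show ?thesis
    using \<open>C > 0\<close> by (simp add: field_simps)
qed

theorem theorem4p1:
  fixes \<mu> :: "((real ^ 'd) \<times> (real ^ 'd)) measure"
    and N :: nat
    and I :: "(real ^ 'd) set"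
    and C r \<epsilon> \<Delta>t D t0 :: real
    and t :: "nat \<Rightarrow> real"
  assumes "prob_space \<mu>" and "sets \<mu> = sets Gamma1"
    and "N \<ge> 1"
    and "I \<in> sets torus"
    and "C > 0" and "r > 0"
    and "\<forall>s>0. \<bar>(\<integral>\<omega>. frac_in I N s \<omega> \<partial>init_distr \<mu> N) - measure torus I\<bar> \<le> C * s powr (- 2 * r)"
    and "\<epsilon> > 0" and "\<Delta>t > 0"
    and "D = (2 * C) powr (1 / (2 * r))"
    and "t0 = \<epsilon> powr (- 1 / (2 * r)) * D"
    and "\<forall>k. t k = t0 + real k * \<Delta>t"
  shows "(\<forall>K::nat. K \<ge> 1 \<longrightarrow>
            measure (init_distr \<mu> N) (Omega_upto I \<epsilon> N t (real K))
              \<ge> 1 - 2 * real K * exp (- (1 / 2) * \<epsilon>\<^sup>2 * real N))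
       \<and> measure (init_distr \<mu> N) (Omega_upto I \<epsilon> N t ((1 / 2) * exp (\<epsilon>\<^sup>2 / 4 * real N)))
            \<ge> 1 - exp (- (1 / 4) * \<epsilon>\<^sup>2 * real N)"
proof -
  let ?P = "init_distr \<mu> N"
  let ?q = "2 * exp (- (1 / 2) * \<epsilon>\<^sup>2 * real N)"
  interpret \<mu>: prob_space \<mu> by fact
  interpret P: prob_space ?P
    unfolding init_distr_def by (intro prob_space_PiM \<mu>.prob_space_axioms)
  \<comment> \<open>\<open>Omega\<close> lives on \<open>Gamma N\<close> while probabilities are
    taken in \<open>?P\<close>; the hypothesis on \<open>sets \<mu>\<close> identifies the two
    spaces.\<close>
  have space_Gamma: "space (Gamma N) = space ?P"
    unfolding Gamma_def init_distr_def
    using sets_eq_imp_space_eq[OF assms(2)] by (simp add: space_PiM)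
  define h where "h s z = periodic_indicator I (fst z + s *\<^sub>R snd z)"
    for s and z :: "(real ^ 'd) \<times> (real ^ 'd)"
  have h: "h s \<in> borel_measurable \<mu>" for s
    using borel_measurable_periodic_indicator_flow[OF assms(4), of s] assms(2)
    by (simp add: h_def[abs_def] cong: measurable_cong_sets)
  have frac_in_h: "frac_in I N s = (\<lambda>\<omega>. (1 / real (card {1..N})) * (\<Sum>i\<in>{1..N}. h s (\<omega> i)))" for s
    by (simp add: frac_in_def h_def fun_eq_iff)
  have "(\<lambda>\<omega>. h s (\<omega> i)) \<in> borel_measurable ?P" if "i \<in> {1..N}" for s i
    unfolding init_distr_def
    by (rule measurable_compose[OF _ h]) (rule measurable_component_singleton[OF that])
  then have frac_in: "frac_in I N s \<in> borel_measurable ?P" for s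
    unfolding frac_in_h
    by (intro borel_measurable_times borel_measurable_const borel_measurable_sum)
  have Omega: "Omega I \<epsilon> N s \<in> sets ?P" for s
    unfolding Omega_def space_Gamma using frac_in by measurable
  have tail: "P.prob (space ?P - Omega I \<epsilon> N (t k)) \<le> ?q" for k
  proof -
    let ?E = "\<integral>\<omega>. frac_in I N (t k) \<omega> \<partial>?P"
    have "t0 > 0" using assms by simp
    moreover have "t k \<ge> t0" using assms(9,12) by simp
    ultimately have "\<bar>?E - measure torus I\<bar> \<le> C * t k powr (- 2 * r)"
      using assms(7) by simp
    also have "\<dots> \<le> \<epsilon> / 2"
      using \<open>t k \<ge> t0\<close> assms(5,6,8,10,11) by (intro decay_at_threshold) simp_all
    finally have bias: "\<bar>?E - measure torus I\<bar> \<le> \<epsilon> / 2" .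
    \<comment> \<open>Triangle inequality: a distance above \<open>\<epsilon>\<close> from
      \<open>measure torus I\<close>, less a bias of at most \<open>\<epsilon> / 2\<close>, leaves
      at least \<open>\<epsilon> / 2\<close> from the mean.\<close>
    have "space ?P - Omega I \<epsilon> N (t k)
        \<subseteq> {\<omega> \<in> space ?P. \<bar>frac_in I N (t k) \<omega> - ?E\<bar> \<ge> \<epsilon> / 2}"
      using bias unfolding Omega_def space_Gamma
      by (auto simp del: le_divide_eq_numeral1 divide_le_eq_numeral1)
    then have "P.prob (space ?P - Omega I \<epsilon> N (t k))
        \<le> P.prob {\<omega> \<in> space ?P. \<bar>frac_in I N (t k) \<omega> - ?E\<bar> \<ge> \<epsilon> / 2}"
      by (intro P.finite_measure_mono) (use frac_in in measurable)
    also have "\<dots> \<le> 2 * exp (- 2 * (\<epsilon> / 2)\<^sup>2 * real (card {1..N}))"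
      unfolding frac_in_h init_distr_def using assms(3,8)
      by (intro iid_average_tail \<mu>.prob_space_axioms h)
        (auto simp: h_def periodic_indicator_def indicator_def)
    also have "\<dots> = ?q" by (simp add: power_divide)
    finally show ?thesis .
  qed
  \<comment> \<open>With real \<open>K\<close>, both claims of the theorem become instances of a
    single bound.\<close>
  have bound: "P.prob (Omega_upto I \<epsilon> N t K) \<ge> 1 - K * ?q" if "K \<ge> 0" for K :: real
  proof -
    \<comment> \<open>The number of times is the floor of \<open>K\<close>, hence at most
      \<open>K\<close>; for \<open>K < 1\<close> there are none.\<close>
    have S: "{k. 1 \<le> k \<and> real k \<le> K} = {1..nat \<lfloor>K\<rfloor>}"
      using that by (auto simp: le_nat_floor le_floor_iff nat_le_iff) linarith+
    have "1 - K * ?q \<le> 1 - real (card {1..nat \<lfloor>K\<rfloor>}) * ?q"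
      using that by (intro diff_left_mono mult_right_mono) (simp_all add: of_nat_floor)
    also have "\<dots> \<le> P.prob (Omega_upto I \<epsilon> N t K)"
      unfolding Omega_upto_def space_Gamma S
      by (intro prob_INT_ge_union_bound P.prob_space_axioms Omega tail) simp
    finally show ?thesis .
  qed
  \<comment> \<open>The factors 1/2 and 2 cancel, and the exponents add up: 1/4 - 1/2 =
    -1/4.\<close>
  have "(1 / 2) * exp (\<epsilon>\<^sup>2 / 4 * real N) * ?q = exp (- (1 / 4) * \<epsilon>\<^sup>2 * real N)"
    by (simp add: exp_add[symmetric])
  with bound[of "(1 / 2) * exp (\<epsilon>\<^sup>2 / 4 * real N)"] bound[of "real _"] show ?thesis
    by (simp add: mult_ac)
qed

end
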